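(* The pseudovariety $\mathsf{CS}$ of all finite completely simple semigroups (in the signature of semigroups) is strong.
   Context: For a pseudovariety $\mathsf U$ and finite set $A$, $\Omega_A\mathsf U$ is the free pro-$\mathsf U$ algebra on $A$ (here the free pro-$\mathsf{CS}$ semigroup). A $\mathsf U$-pseudoidentity is $u=v$ with $u,v\in\Omega_B\mathsf U$, $B$ finite; it holds in $T\in\mathsf U$ if both sides agree under every continuous homomorphism $\Omega_B\mathsf U\to T$; $[\![\Sigma]\!]_{\mathsf U}$ is the class of members of $\mathsf U$ satisfying $\Sigma$. Provability: for a set $\Sigma$ of $\mathsf U$-pseudoidentities and finite $A$, $\Sigma_0\subseteq\Omega_A\mathsf U\times\Omega_A\mathsf U$ is the set of pairs $(\mathbf t(\varphi(u),w_1,\dots,w_n),\mathbf t(\varphi(v),w_1,\dots,w_n))$ with $u=v$ or $v=u$ in $\Sigma$ ($u,v\in\Omega_B\mathsf U$), $\varphi:\Omega_B\mathsf U\to\Omega_A\mathsf U$ a continuous homomorphism, $\mathbf t$ a semigroup term, $w_i\in\Omega_A\mathsf U$; $\Sigma_{2\alpha+1}$ is the transitive closure of $\Sigma_{2\alpha}$, $\Sigma_{2\alpha+2}$ the topological closure of $\Sigma_{2\alpha+1}$, unions at limit ordinals; $u=v$ is provable from $\Sigma$ if $(u,v)\in\bigcup_\alpha\Sigma_\alpha$. $\mathsf U$ is strong if for every set $\Sigma$ of $\mathsf U$-pseudoidentities, every $\mathsf U$-pseudoidentity valid in $[\![\Sigma]\!]_{\mathsf U}$ is provable from $\Sigma$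.
   Formalization: The set Σ of pseudoidentities is assumed to be non-empty: for empty Σ the set Σ_0 is empty, so not even x = x, which holds in all of CS, would be provable under the stated definition. *)

theory Defs
  imports Main "HOL-Library.FuncSet"
begin

text \<open>A (finite) semigroup is represented by a carrier set of naturals and a multiplication.
  Every finite semigroup is isomorphic to such a one, so classes of finite semigroups
  (closed under isomorphism) are faithfully represented.\<close>

type_synonym sg = "nat set \<times> (nat \<Rightarrow> nat \<Rightarrow> nat)"

definition carr :: "sg \<Rightarrow> nat set" where "carr S = fst S"
definition mul :: "sg \<Rightarrow> nat \<Rightarrow> nat \<Rightarrow> nat" where "mul S = snd S"

definition is_semigroup :: "sg \<Rightarrow> bool" where
  "is_semigroup S \<longleftrightarrow>
     (\<forall>x\<in>carr S. \<forall>y\<in>carr S. mul S x y \<in> carr S) \<and>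
     (\<forall>x\<in>carr S. \<forall>y\<in>carr S. \<forall>z\<in>carr S. mul S (mul S x y) z = mul S x (mul S y z))"

definition is_simple :: "sg \<Rightarrow> bool" where
  "is_simple S \<longleftrightarrow>
     (\<forall>I. I \<noteq> {} \<and> I \<subseteq> carr S \<and> (\<forall>s\<in>carr S. \<forall>x\<in>I. mul S s x \<in> I \<and> mul S x s \<in> I)
          \<longrightarrow> I = carr S)"

definition primitive_idem :: "sg \<Rightarrow> nat \<Rightarrow> bool" where
  "primitive_idem S e \<longleftrightarrow> e \<in> carr S \<and> mul S e e = e \<and>
     (\<forall>f\<in>carr S. mul S f f = f \<and> mul S e f = f \<and> mul S f e = f \<longrightarrow> f = e)"

definition CS :: "sg \<Rightarrow> bool" where
  "CS S \<longleftrightarrow> is_semigroup S \<and> finite (carr S) \<and> is_simple S \<and> (\<exists>e. primitive_idem S e)"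

definition sg_hom :: "sg \<Rightarrow> sg \<Rightarrow> (nat \<Rightarrow> nat) \<Rightarrow> bool" where
  "sg_hom S T h \<longleftrightarrow> (\<forall>x\<in>carr S. h x \<in> carr T) \<and>
     (\<forall>x\<in>carr S. \<forall>y\<in>carr S. h (mul S x y) = mul T (h x) (h y))"

section \<open>The free pro-CS semigroup \<open>\<Omega>_A CS\<close> as the algebra of A-ary implicit operations on CS\<close>

type_synonym io = "sg \<Rightarrow> (nat \<Rightarrow> nat) \<Rightarrow> nat"

definition coord :: "nat set \<Rightarrow> sg \<Rightarrow> (nat \<Rightarrow> nat) \<Rightarrow> bool" where
  "coord A S f \<longleftrightarrow> CS S \<and> f \<in> PiE A (\<lambda>_. carr S)"

definition Omega :: "nat set \<Rightarrow> io set" where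
  "Omega A = {u.
     (\<forall>S f. coord A S f \<longrightarrow> u S f \<in> carr S) \<and>
     (\<forall>S f. \<not> coord A S f \<longrightarrow> u S f = undefined) \<and>
     (\<forall>S T f h. coord A S f \<and> CS T \<and> sg_hom S T h \<longrightarrow>
          h (u S f) = u T (restrict (h \<circ> f) A))}"

definition io_mult :: "nat set \<Rightarrow> io \<Rightarrow> io \<Rightarrow> io" where
  "io_mult A u v = (\<lambda>S f. if coord A S f then mul S (u S f) (v S f) else undefined)"

text \<open>The topology of \<open>\<Omega>_A CS\<close> is pointwise convergence (finite semigroups discrete):
  basic neighbourhoods of u are the sets of elements agreeing with u on finitely many coordinates.\<close>
definition agree :: "(sg \<times> (nat \<Rightarrow> nat)) set \<Rightarrow> io \<Rightarrow> io \<Rightarrow> bool" where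
  "agree F u v \<longleftrightarrow> (\<forall>p\<in>F. u (fst p) (snd p) = v (fst p) (snd p))"

definition cont_hom :: "nat set \<Rightarrow> nat set \<Rightarrow> (io \<Rightarrow> io) \<Rightarrow> bool" where
  "cont_hom B A \<phi> \<longleftrightarrow>
     (\<forall>u\<in>Omega B. \<phi> u \<in> Omega A) \<and>
     (\<forall>u\<in>Omega B. \<forall>v\<in>Omega B. \<phi> (io_mult B u v) = io_mult A (\<phi> u) (\<phi> v)) \<and>
     (\<forall>u\<in>Omega B. \<forall>F. finite F \<longrightarrow>
        (\<exists>G. finite G \<and> (\<forall>u'\<in>Omega B. agree G u u' \<longrightarrow> agree F (\<phi> u) (\<phi> u'))))"

definition cont_hom_to :: "nat set \<Rightarrow> sg \<Rightarrow> (io \<Rightarrow> nat) \<Rightarrow> bool" where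
  "cont_hom_to B T \<psi> \<longleftrightarrow>
     (\<forall>u\<in>Omega B. \<psi> u \<in> carr T) \<and>
     (\<forall>u\<in>Omega B. \<forall>v\<in>Omega B. \<psi> (io_mult B u v) = mul T (\<psi> u) (\<psi> v)) \<and>
     (\<forall>u\<in>Omega B. \<exists>G. finite G \<and> (\<forall>u'\<in>Omega B. agree G u u' \<longrightarrow> \<psi> u' = \<psi> u))"

definition is_pseudoid :: "nat set \<times> io \<times> io \<Rightarrow> bool" where
  "is_pseudoid p \<longleftrightarrow> (case p of (B, u, v) \<Rightarrow> finite B \<and> u \<in> Omega B \<and> v \<in> Omega B)"

definition holds_in :: "sg \<Rightarrow> nat set \<times> io \<times> io \<Rightarrow> bool" where
  "holds_in T p \<longleftrightarrow> (case p of (B, u, v) \<Rightarrow> \<forall>\<psi>. cont_hom_to B T \<psi> \<longrightarrow> \<psi> u = \<psi> v)"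

definition models :: "(nat set \<times> io \<times> io) set \<Rightarrow> sg set" where
  "models \<Sigma> = {T. CS T \<and> (\<forall>p\<in>\<Sigma>. holds_in T p)}"

datatype sterm = Var nat | Mul sterm sterm

fun eval_term :: "nat set \<Rightarrow> (nat \<Rightarrow> io) \<Rightarrow> sterm \<Rightarrow> io" where
  "eval_term A env (Var i) = env i"
| "eval_term A env (Mul s t) = io_mult A (eval_term A env s) (eval_term A env t)"

definition Sigma0 :: "(nat set \<times> io \<times> io) set \<Rightarrow> nat set \<Rightarrow> (io \<times> io) set" where
  "Sigma0 \<Sigma> A = {(eval_term A (env(0 := \<phi> u)) t, eval_term A (env(0 := \<phi> v)) t) | B u v \<phi> env t.
      ((B, u, v) \<in> \<Sigma> \<or> (B, v, u) \<in> \<Sigma>) \<and> cont_hom B A \<phi> \<and> (\<forall>i. env i \<in> Omega A)}"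

text \<open>Provable pairs: the union of the transfinite sequence \<open>\<Sigma>_\<alpha>\<close> (alternately transitive
  and topological closures in \<open>\<Omega>_A CS \<times> \<Omega>_A CS\<close>), i.e. the least relation containing
  \<open>\<Sigma>_0\<close> that is closed under transitivity and under topological closure.\<close>
inductive provable :: "(nat set \<times> io \<times> io) set \<Rightarrow> nat set \<Rightarrow> io \<Rightarrow> io \<Rightarrow> bool"
  for \<Sigma> :: "(nat set \<times> io \<times> io) set" and A :: "nat set" where
  base: "(u, v) \<in> Sigma0 \<Sigma> A \<Longrightarrow> provable \<Sigma> A u v"
| trans: "provable \<Sigma> A u v \<Longrightarrow> provable \<Sigma> A v w \<Longrightarrow> provable \<Sigma> A u w"
| limit: "u \<in> Omega A \<Longrightarrow> v \<in> Omega A \<Longrightarrow>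
          (\<forall>F. finite F \<longrightarrow> (\<exists>u' v'. provable \<Sigma> A u' v' \<and> agree F u u' \<and> agree F v v'))
          \<Longrightarrow> provable \<Sigma> A u v"

end

theory Submission
  imports Defs
begin

text \<open>Provability from \<open>\<Sigma>\<close> is a topologically closed congruence \<open>\<sim>\<close> on \<open>\<Omega>\<^sub>A CS\<close>. For a finite set \<open>F\<close> of
  coordinates let \<open>\<theta>\<^sub>F\<close> be agreement on \<open>F\<close>, a congruence of finite index. If \<open>F\<close> contains the free
  rectangular band on \<open>A\<close>, then \<open>\<theta>\<^sub>F\<close> lies inside Green's relation \<open>H\<close>, and a Mal'cev-like term shows
  that \<open>\<sim>\<close> and \<open>\<theta>\<^sub>F\<close> permute, so that \<open>\<sim> \<circ> \<theta>\<^sub>F\<close> is a congruence of finite index. Its quotient is a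
  finite completely simple semigroup that satisfies \<open>\<Sigma>\<close>, hence also \<open>u = v\<close>. As this holds for all
  large \<open>F\<close>, the pair \<open>(u, v)\<close> is a limit of provable pairs and is itself provable.\<close>

section \<open>Finite completely simple semigroups\<close>

text \<open>Simplicity writes \<open>x\<close> as \<open>a z b\<close> with
  \<open>z = x y y y x\<close>. Then \<open>k \<mapsto> a k b\<close> maps \<open>x y S y x\<close>
  onto a set containing \<open>x\<close> and \<open>x S x\<close>, hence containing
  \<open>x y S y x\<close> itself. Counting forces equality, so \<open>x\<close> lies in
  \<open>x y S y x\<close>.\<close>

lemma CS_divE:
  assumes "CS S" "x \<in> carr S" "y \<in> carr S"
  obtains s where "s \<in> carr S" "mul S x (mul S y (mul S s (mul S y x))) = x"
proof -
  have fin: "finite (carr S)" and simple: "is_simple S" and "is_semigroup S"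
    using assms by (auto simp: CS_def)
  then have closed [simp]: "\<And>a b. a \<in> carr S \<Longrightarrow> b \<in> carr S \<Longrightarrow> mul S a b \<in> carr S"
    and assoc [simp]: "\<And>a b c. a \<in> carr S \<Longrightarrow> b \<in> carr S \<Longrightarrow> c \<in> carr S \<Longrightarrow>
      mul S (mul S a b) c = mul S a (mul S b c)"
    by (auto simp: is_semigroup_def)
  note [simp] = assms(2,3)
  \<comment> \<open>Three copies of \<open>y\<close>: the middle one is the \<open>s\<close> that
    puts \<open>z\<close> into \<open>x y S y x\<close>.\<close>
  define z where "z = mul S x (mul S y (mul S y (mul S y x)))"
  have z [simp]: "z \<in> carr S" by (simp add: z_def)
  define I where "I = {mul S a (mul S z b) | a b. a \<in> carr S \<and> b \<in> carr S}"
  have "mul S s i \<in> I \<and> mul S i s \<in> I" if "s \<in> carr S" "i \<in> I" for s i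
  proof -
    obtain a b where ab: "a \<in> carr S" "b \<in> carr S" "i = mul S a (mul S z b)"
      using \<open>i \<in> I\<close> unfolding I_def by blast
    have "mul S s i = mul S (mul S s a) (mul S z b)" "mul S i s = mul S a (mul S z (mul S b s))"
      using that ab by simp_all
    then show ?thesis unfolding I_def using that ab closed by blast
  qed
  moreover have "I \<noteq> {}" using assms(2) unfolding I_def by blast
  moreover have "I \<subseteq> carr S" by (auto simp: I_def)
  ultimately have "I = carr S" using simple by (simp add: is_simple_def)
  then have "x \<in> I" by simp
  then obtain a b where a [simp]: "a \<in> carr S" and b [simp]: "b \<in> carr S"
    and xab: "x = mul S a (mul S z b)" by (auto simp: I_def)
  define M where "M = (\<lambda>s. mul S x (mul S y (mul S s (mul S y x)))) ` carr S"
  define N where "N = insert x ((\<lambda>s. mul S x (mul S s x)) ` carr S)"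
  have "M \<subseteq> N"
  proof
    fix k assume "k \<in> M"
    then obtain s where s: "s \<in> carr S" "k = mul S x (mul S y (mul S s (mul S y x)))"
      by (auto simp: M_def)
    then have "k = mul S x (mul S (mul S y (mul S s y)) x)" by simp
    then show "k \<in> N" unfolding N_def using s
      by (intro insertI2 image_eqI[where x = "mul S y (mul S s y)"]) auto
  qed
  moreover have "N \<subseteq> (\<lambda>k. mul S a (mul S k b)) ` M"
  proof
    fix k assume "k \<in> N"
    then consider "k = x" | s where "s \<in> carr S" "k = mul S x (mul S s x)"
      by (auto simp: N_def)
    then show "k \<in> (\<lambda>k. mul S a (mul S k b)) ` M"
    proof cases
      case 1
      have "z \<in> M" unfolding M_def z_def by (intro image_eqI) auto
      then show ?thesis using xab 1 by auto
    next
      case 2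
      \<comment> \<open>Here \<open>x s x = a (z b s a z) b\<close>, and \<open>?r\<close> is
        \<open>z b s a z\<close> with the outer \<open>x y\<close> and \<open>y x\<close> stripped
        off.\<close>
      let ?r = "mul S y (mul S y (mul S x (mul S b (mul S s (mul S a (mul S x (mul S y y)))))))"
      have "k = mul S (mul S a (mul S z b)) (mul S s (mul S a (mul S z b)))"
        using 2 xab by simp
      also have "\<dots> = mul S a (mul S (mul S x (mul S y (mul S ?r (mul S y x)))) b)"
        using 2 by (simp add: z_def)
      finally have "k = mul S a (mul S (mul S x (mul S y (mul S ?r (mul S y x)))) b)" .
      moreover have "mul S x (mul S y (mul S ?r (mul S y x))) \<in> M"
        unfolding M_def by (rule imageI) (use 2 in simp)
      ultimately show ?thesis by (rule image_eqI)
    qed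
  qed
  then have "card N \<le> card M"
    using fin unfolding M_def by (meson card_image_le card_mono finite_imageI le_trans)
  moreover have "finite N" using fin by (simp add: N_def)
  ultimately have "M = N" by (simp add: card_seteq)
  then have "x \<in> M" by (simp add: N_def)
  then show thesis using that by (auto simp: M_def)
qed

text \<open>Converse of \<open>CS_divE\<close>. An ideal containing \<open>y\<close> contains every
  \<open>x = x y s y x\<close>. If \<open>f\<close> lies below the idempotent \<open>e\<close>,
  dividing \<open>e\<close> by \<open>f\<close> gives \<open>e = f s f\<close>, hence
  \<open>f e = e\<close>.\<close>

lemma CSI:
  assumes closed: "\<And>x y. x \<in> carr S \<Longrightarrow> y \<in> carr S \<Longrightarrow> mul S x y \<in> carr S"
    and assoc: "\<And>x y z. x \<in> carr S \<Longrightarrow> y \<in> carr S \<Longrightarrow> z \<in> carr S \<Longrightarrow>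
      mul S (mul S x y) z = mul S x (mul S y z)"
    and fin: "finite (carr S)" and ne: "carr S \<noteq> {}"
    and div: "\<And>x y. x \<in> carr S \<Longrightarrow> y \<in> carr S \<Longrightarrow>
      \<exists>s\<in>carr S. mul S x (mul S y (mul S s (mul S y x))) = x"
  shows "CS S"
proof -
  note [simp] = closed assoc
  have "is_simple S"
    unfolding is_simple_def
  proof (intro allI impI)
    fix I assume I: "I \<noteq> {} \<and> I \<subseteq> carr S \<and>
      (\<forall>s\<in>carr S. \<forall>x\<in>I. mul S s x \<in> I \<and> mul S x s \<in> I)"
    then obtain y where y: "y \<in> I" "y \<in> carr S" by auto
    have "x \<in> I" if x: "x \<in> carr S" for x
      using div[OF x y(2)] I x y closed by metis
    then show "I = carr S" using I by auto
  qed
  moreover obtain e where e: "e \<in> carr S" "mul S e e = e"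
  proof -
    obtain x where x: "x \<in> carr S" using ne by auto
    obtain s where s: "s \<in> carr S" "mul S x (mul S x (mul S s (mul S x x))) = x"
      using div[OF x x] by auto
    \<comment> \<open>These undo the squaring of \<open>x\<close> from either side, so
      \<open>?l x = x ?r\<close> is the identity of a subgroup containing \<open>x\<close>.\<close>
    let ?l = "mul S x (mul S x s)" and ?r = "mul S s (mul S x x)"
    have l: "mul S ?l (mul S x x) = x" and r: "mul S (mul S x x) ?r = x" using x s by simp_all
    have "mul S ?l x = mul S ?l (mul S (mul S x x) ?r)" by (simp only: r)
    also have "\<dots> = mul S (mul S ?l (mul S x x)) ?r"
      by (rule assoc[symmetric]) (use x s in simp_all)
    finally have lr: "mul S ?l x = mul S x ?r" by (simp only: l)
    have "mul S (mul S x ?r) (mul S x ?r) = mul S (mul S ?l x) (mul S x ?r)" by (simp only: lr)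
    also have "\<dots> = mul S ?l (mul S (mul S x x) ?r)" using x s by simp
    finally have "mul S (mul S x ?r) (mul S x ?r) = mul S x ?r" by (simp only: r lr)
    then show thesis using that x s by (metis closed)
  qed
  moreover have "primitive_idem S e"
    unfolding primitive_idem_def
  proof (intro conjI ballI impI)
    fix f assume f: "f \<in> carr S" "mul S f f = f \<and> mul S e f = f \<and> mul S f e = f"
    obtain s where s: "s \<in> carr S" "mul S e (mul S f (mul S s (mul S f e))) = e"
      using div[OF e(1) f(1)] by auto
    then have "mul S f (mul S s f) = e" using e f by (metis assoc closed)
    then have "mul S f e = e" using f s by (metis assoc closed)
    then show "f = e" using f by simp
  qed (use e in auto)
  ultimately show ?thesis using fin by (auto simp: CS_def is_semigroup_def)
qed

text \<open>Covers both quotients of \<open>\<Omega>\<^sub>A CS\<close> and subsemigroups of products; the hypotheses are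
  stated modulo the kernel of \<open>f\<close> so that \<open>X\<close> itself may be infinite.\<close>

lemma CS_of_finite_image:
  fixes X :: "'a set" and f :: "'a \<Rightarrow> 'b"
  assumes ne: "X \<noteq> {}" and closed: "\<And>x y. x \<in> X \<Longrightarrow> y \<in> X \<Longrightarrow> m x y \<in> X"
    and fin: "finite (f ` X)"
    and cong: "\<And>x x' y y'. x \<in> X \<Longrightarrow> x' \<in> X \<Longrightarrow> y \<in> X \<Longrightarrow> y' \<in> X \<Longrightarrow>
      f x = f x' \<Longrightarrow> f y = f y' \<Longrightarrow> f (m x y) = f (m x' y')"
    and assoc: "\<And>x y z. x \<in> X \<Longrightarrow> y \<in> X \<Longrightarrow> z \<in> X \<Longrightarrow> f (m (m x y) z) = f (m x (m y z))"
    and div: "\<And>x y. x \<in> X \<Longrightarrow> y \<in> X \<Longrightarrow> \<exists>s\<in>X. f (m x (m y (m s (m y x)))) = f x"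
  obtains T \<pi> where "CS T" "carr T = \<pi> ` X"
    "\<And>x y. x \<in> X \<Longrightarrow> y \<in> X \<Longrightarrow> \<pi> (m x y) = mul T (\<pi> x) (\<pi> y)"
    "\<And>x y. x \<in> X \<Longrightarrow> y \<in> X \<Longrightarrow> \<pi> x = \<pi> y \<longleftrightarrow> f x = f y"
proof -
  \<comment> \<open>The carrier of an \<open>sg\<close> consists of naturals, so the finitely many
    values of \<open>f\<close> are numbered.\<close>
  obtain e :: "'b \<Rightarrow> nat" where e: "inj_on e (f ` X)"
    using finite_imp_inj_to_nat_seg[OF fin] by auto
  define \<pi> where "\<pi> = (\<lambda>x. e (f x))"
  have ker: "\<pi> x = \<pi> y \<longleftrightarrow> f x = f y" if "x \<in> X" "y \<in> X" for x y
    using e that by (auto simp: \<pi>_def inj_on_def)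
  define rep where "rep n = (SOME x. x \<in> X \<and> \<pi> x = n)" for n
  have rep: "rep (\<pi> x) \<in> X \<and> \<pi> (rep (\<pi> x)) = \<pi> x" if "x \<in> X" for x
    unfolding rep_def by (rule someI[of _ x]) (use that in simp)
  define T :: sg where "T = (\<pi> ` X, \<lambda>a b. \<pi> (m (rep a) (rep b)))"
  have carr: "carr T = \<pi> ` X" by (simp add: carr_def T_def)
  have hom: "\<pi> (m x y) = mul T (\<pi> x) (\<pi> y)" if "x \<in> X" "y \<in> X" for x y
  proof -
    have "f (m x y) = f (m (rep (\<pi> x)) (rep (\<pi> y)))"
      using rep that ker by (intro cong) (metis)+
    then show ?thesis by (simp add: mul_def T_def \<pi>_def)
  qed
  have "CS T"
  proof (rule CSI)
    show "finite (carr T)" using fin by (simp add: carr \<pi>_def image_image[symmetric, of e f])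
    show "carr T \<noteq> {}" using ne by (simp add: carr)
    show "mul T x y \<in> carr T" if "x \<in> carr T" "y \<in> carr T" for x y
      using that closed by (auto simp: carr hom[symmetric])
    show "mul T (mul T x y) z = mul T x (mul T y z)"
      if "x \<in> carr T" "y \<in> carr T" "z \<in> carr T" for x y z
      using that assoc closed ker by (auto simp: carr hom[symmetric])
    show "\<exists>s\<in>carr T. mul T x (mul T y (mul T s (mul T y x))) = x"
      if xy: "x \<in> carr T" "y \<in> carr T" for x y
    proof -
      obtain x' y' where *: "x' \<in> X" "y' \<in> X" "x = \<pi> x'" "y = \<pi> y'" using xy by (auto simp: carr)
      obtain s where "s \<in> X" "f (m x' (m y' (m s (m y' x')))) = f x'" using div * by blast
      with * show ?thesis
        by (intro bexI[of _ "\<pi> s"]) (simp_all add: carr hom[symmetric] closed ker)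
    qed
  qed
  then show thesis using carr hom ker by (rule that)
qed

section \<open>Group inverses in a completely simple semigroup\<close>

locale cs =
  fixes S :: sg
  assumes CS: "CS S"
begin

abbreviation times (infixl "\<cdot>" 70) where "x \<cdot> y \<equiv> mul S x y"

lemma closed [simp]: "x \<in> carr S \<Longrightarrow> y \<in> carr S \<Longrightarrow> x \<cdot> y \<in> carr S"
  using CS by (auto simp: CS_def is_semigroup_def)

lemma assoc [simp]:
  "x \<in> carr S \<Longrightarrow> y \<in> carr S \<Longrightarrow> z \<in> carr S \<Longrightarrow> x \<cdot> y \<cdot> z = x \<cdot> (y \<cdot> z)"
  using CS by (auto simp: CS_def is_semigroup_def)

lemma left_divE:
  assumes "x \<in> carr S" "y \<in> carr S"
  obtains s where "s \<in> carr S" "s \<cdot> (y \<cdot> x) = x"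
proof -
  obtain s where "s \<in> carr S" "x \<cdot> (y \<cdot> (s \<cdot> (y \<cdot> x))) = x" using CS_divE[OF CS assms] .
  then show thesis using assms that[of "x \<cdot> (y \<cdot> s)"] by simp
qed

lemma right_divE:
  assumes "x \<in> carr S" "y \<in> carr S"
  obtains s where "s \<in> carr S" "x \<cdot> (y \<cdot> s) = x"
proof -
  obtain s where "s \<in> carr S" "x \<cdot> (y \<cdot> (s \<cdot> (y \<cdot> x))) = x" using CS_divE[OF CS assms] .
  then show thesis using assms that[of "s \<cdot> (y \<cdot> x)"] by simp
qed

text \<open>The inverse of \<open>x\<close> in the maximal subgroup containing it; commutation is
  what makes it unique.\<close>

definition is_inv :: "nat \<Rightarrow> nat \<Rightarrow> bool" where
  "is_inv x y \<longleftrightarrow> y \<in> carr S \<and> x \<cdot> y \<cdot> x = x \<and> y \<cdot> x \<cdot> y = y \<and> x \<cdot> y = y \<cdot> x"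

lemma is_inv_unique:
  assumes "x \<in> carr S" "is_inv x y" "is_inv x z"
  shows "y = z"
proof -
  note [simp] = assms(1)
  have [simp]: "y \<in> carr S" "z \<in> carr S" using assms by (auto simp: is_inv_def)
  have y: "x \<cdot> y \<cdot> x = x" "y \<cdot> x \<cdot> y = y" "x \<cdot> y = y \<cdot> x"
    and z: "x \<cdot> z \<cdot> x = x" "z \<cdot> x \<cdot> z = z" "x \<cdot> z = z \<cdot> x"
    using assms by (auto simp only: is_inv_def)
  have "x \<cdot> z = (x \<cdot> y \<cdot> x) \<cdot> z" by (simp only: y(1))
  also have "\<dots> = (x \<cdot> y) \<cdot> (x \<cdot> z)" by simp
  also have "\<dots> = (y \<cdot> x) \<cdot> (z \<cdot> x)" by (simp only: y(3) z(3))
  also have "\<dots> = y \<cdot> (x \<cdot> z \<cdot> x)" by simp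
  finally have xz: "x \<cdot> z = x \<cdot> y" by (simp only: y(3) z(1))
  have "y = (y \<cdot> x) \<cdot> y" by (simp only: y(2))
  also have "\<dots> = (x \<cdot> z) \<cdot> y" by (simp only: y(3) xz)
  also have "\<dots> = (z \<cdot> x) \<cdot> y" by (simp only: z(3))
  also have "\<dots> = z \<cdot> (x \<cdot> y)" by simp
  also have "\<dots> = z \<cdot> (x \<cdot> z)" by (simp only: xz)
  also have "\<dots> = z \<cdot> x \<cdot> z" by simp
  finally show ?thesis by (simp only: z(2))
qed

text \<open>Dividing \<open>x\<close> by its square on each side gives
  \<open>s x x = x = x x t\<close>. Then \<open>s x = x t\<close> is the identity of the subgroup
  around \<open>x\<close>, and \<open>s x t\<close> is the inverse.\<close>

lemma ex_is_inv:
  assumes x [simp]: "x \<in> carr S"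
  shows "\<exists>y. is_inv x y"
proof -
  obtain s where s [simp]: "s \<in> carr S" and sx: "s \<cdot> (x \<cdot> x) = x" using left_divE[OF x x] .
  obtain t where t [simp]: "t \<in> carr S" and tx: "x \<cdot> (x \<cdot> t) = x" using right_divE[OF x x] .
  have "s \<cdot> x = s \<cdot> (x \<cdot> (x \<cdot> t))" by (simp only: tx)
  also have "\<dots> = (s \<cdot> (x \<cdot> x)) \<cdot> t" by simp
  finally have st: "s \<cdot> x = x \<cdot> t" by (simp only: sx)
  have a: "x \<cdot> (s \<cdot> x \<cdot> t) = x \<cdot> t"
  proof -
    have "x \<cdot> (s \<cdot> x \<cdot> t) = x \<cdot> (x \<cdot> t) \<cdot> t" by (simp only: st assoc x t closed)
    then show ?thesis by (simp only: tx)
  qed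
  have b: "(s \<cdot> x \<cdot> t) \<cdot> x = x \<cdot> t"
  proof -
    have "(s \<cdot> x \<cdot> t) \<cdot> x = s \<cdot> (x \<cdot> t) \<cdot> x" by simp
    also have "\<dots> = s \<cdot> (s \<cdot> x) \<cdot> x" by (simp only: st)
    also have "\<dots> = s \<cdot> (s \<cdot> (x \<cdot> x))" by simp
    finally show ?thesis by (simp only: sx st)
  qed
  have c: "x \<cdot> t \<cdot> x = x"
  proof -
    have "x \<cdot> t \<cdot> x = s \<cdot> x \<cdot> x" by (simp only: st)
    then show ?thesis using sx by simp
  qed
  have d: "x \<cdot> t \<cdot> (s \<cdot> x \<cdot> t) = s \<cdot> x \<cdot> t"
  proof -
    have "x \<cdot> t \<cdot> (s \<cdot> x \<cdot> t) = (s \<cdot> x) \<cdot> ((x \<cdot> t) \<cdot> t)" by (simp only: st)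
    also have "\<dots> = (s \<cdot> (x \<cdot> x)) \<cdot> t \<cdot> t" by simp
    also have "\<dots> = s \<cdot> x \<cdot> t" by (simp only: sx st)
    finally show ?thesis .
  qed
  have "is_inv x (s \<cdot> x \<cdot> t)"
    unfolding is_inv_def a b c d by simp
  then show ?thesis ..
qed

definition ginv :: "nat \<Rightarrow> nat" where "ginv x = (THE y. is_inv x y)"

lemma is_inv_ginv: "x \<in> carr S \<Longrightarrow> is_inv x (ginv x)"
  unfolding ginv_def by (rule theI') (use ex_is_inv is_inv_unique in blast)

lemma ginv_eq: "x \<in> carr S \<Longrightarrow> is_inv x y \<Longrightarrow> ginv x = y"
  using is_inv_ginv is_inv_unique by blast

lemma ginv_closed [simp]: "x \<in> carr S \<Longrightarrow> ginv x \<in> carr S"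
  using is_inv_ginv by (auto simp: is_inv_def)

lemma ginv_cancel:
  assumes "x \<in> carr S"
  shows "x \<cdot> (ginv x \<cdot> x) = x" "ginv x \<cdot> (x \<cdot> ginv x) = ginv x" "x \<cdot> ginv x = ginv x \<cdot> x"
  using is_inv_ginv[OF assms] assms unfolding is_inv_def by (metis assoc)+

text \<open>The idempotent \<open>ginv (y x) (y x)\<close> is a right identity for
  \<open>y x\<close>, hence also for \<open>x = s (y x)\<close>.\<close>

lemma ginv_right_unit:
  assumes [simp]: "x \<in> carr S" "y \<in> carr S"
  shows "x \<cdot> (ginv (y \<cdot> x) \<cdot> (y \<cdot> x)) = x"
proof -
  obtain s where [simp]: "s \<in> carr S" and s: "s \<cdot> (y \<cdot> x) = x" using left_divE assms .
  have "x \<cdot> (ginv (y \<cdot> x) \<cdot> (y \<cdot> x)) = s \<cdot> (y \<cdot> x) \<cdot> (ginv (y \<cdot> x) \<cdot> (y \<cdot> x))"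
    by (simp only: s)
  also have "\<dots> = s \<cdot> ((y \<cdot> x) \<cdot> (ginv (y \<cdot> x) \<cdot> (y \<cdot> x)))"
    by (rule assoc) simp_all
  finally show ?thesis by (simp only: ginv_cancel s closed assms)
qed

lemma ginv_mult_idem:
  assumes "x \<in> carr S"
  shows "ginv x \<cdot> x \<cdot> (ginv x \<cdot> x) = ginv x \<cdot> x"
  using ginv_cancel(2)[OF assms] by (metis assms assoc closed ginv_closed)

lemma ginv_idem:
  assumes [simp]: "x \<in> carr S"
  shows "ginv (ginv x \<cdot> x) = ginv x \<cdot> x"
proof (rule ginv_eq)
  show "is_inv (ginv x \<cdot> x) (ginv x \<cdot> x)"
    unfolding is_inv_def by (simp only: ginv_mult_idem closed ginv_closed assms simp_thms)
qed simp

lemma ginv_mult_square: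
  assumes "x \<in> carr S"
  shows "ginv x \<cdot> (x \<cdot> x) = x" "ginv x \<cdot> (ginv x \<cdot> x) = ginv x"
  using assms ginv_cancel[OF assms] by (metis assoc ginv_closed)+

text \<open>With \<open>z = ginv w\<close> this is \<open>p(x, w, w) = x\<close> for the term
  \<open>p(u, w, v) = u ginv(z u) z v z u\<close> that later makes congruences permute. Since
  \<open>z w z = z\<close>, the tail shrinks to \<open>z x\<close>, and \<open>ginv(z x) z x\<close>
  fixes \<open>x\<close>.\<close>

lemma malcev_right:
  assumes [simp]: "x \<in> carr S" "w \<in> carr S"
  shows "x \<cdot> (ginv (ginv w \<cdot> x) \<cdot> (ginv w \<cdot> (w \<cdot> (ginv w \<cdot> x)))) = x"
proof -
  have "ginv w \<cdot> (w \<cdot> (ginv w \<cdot> x)) = (ginv w \<cdot> (w \<cdot> ginv w)) \<cdot> x" by simp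
  then have "ginv w \<cdot> (w \<cdot> (ginv w \<cdot> x)) = ginv w \<cdot> x"
    by (simp only: ginv_cancel(2) assms)
  then show ?thesis by (simp only: ginv_right_unit ginv_closed assms)
qed

text \<open>The identity \<open>p(w, w, y) = y\<close> for the same term. The hypotheses place
  \<open>y\<close> in \<open>w S\<close> and \<open>S w\<close>, where \<open>w ginv w\<close> is a
  left and \<open>ginv w w\<close> a right identity; the inverse in the term is that of an
  idempotent.\<close>

lemma malcev_left:
  assumes [simp]: "w \<in> carr S" and s: "s \<in> carr S" "y = w \<cdot> s" and t: "t \<in> carr S" "y = t \<cdot> w"
  shows "w \<cdot> (ginv (ginv w \<cdot> w) \<cdot> (ginv w \<cdot> (y \<cdot> (ginv w \<cdot> w)))) = y"
proof -
  have y [simp]: "y \<in> carr S" using s by simp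
  have l: "w \<cdot> (ginv w \<cdot> y) = y"
  proof -
    have "w \<cdot> (ginv w \<cdot> (w \<cdot> s)) = (w \<cdot> (ginv w \<cdot> w)) \<cdot> s" using s(1) by simp
    then show ?thesis by (simp only: s(2) ginv_cancel(1) assms(1))
  qed
  have r: "y \<cdot> (ginv w \<cdot> w) = y"
  proof -
    have "(t \<cdot> w) \<cdot> (ginv w \<cdot> w) = t \<cdot> (w \<cdot> (ginv w \<cdot> w))" using t(1) by simp
    then show ?thesis by (simp only: t(2) ginv_cancel(1) assms(1))
  qed
  have "w \<cdot> ((ginv w \<cdot> w) \<cdot> (ginv w \<cdot> y)) = (w \<cdot> (ginv w \<cdot> w)) \<cdot> (ginv w \<cdot> y)" by simp
  also have "\<dots> = y" by (simp only: ginv_cancel(1) assms(1) l)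
  finally show ?thesis by (simp only: r ginv_idem assms(1))
qed

text \<open>Gives the explicit divisor \<open>s = ginv(x y) x ginv(y x)\<close> for the equation in
  \<open>CSI\<close>. Being built from products and inverses, it makes sense uniformly for implicit
  operations.\<close>

lemma mult_ginv_absorb:
  assumes [simp]: "x \<in> carr S" "y \<in> carr S"
  shows "x \<cdot> (y \<cdot> (ginv (x \<cdot> y) \<cdot> (x \<cdot> (ginv (y \<cdot> x) \<cdot> (y \<cdot> x))))) = x"
proof -
  obtain t where [simp]: "t \<in> carr S" and t: "x \<cdot> (y \<cdot> t) = x" using right_divE assms .
  have "x \<cdot> (y \<cdot> (ginv (x \<cdot> y) \<cdot> (x \<cdot> (y \<cdot> t)))) =
    ((x \<cdot> y) \<cdot> (ginv (x \<cdot> y) \<cdot> (x \<cdot> y))) \<cdot> t" by simp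
  also have "\<dots> = x \<cdot> y \<cdot> t" by (simp only: ginv_cancel(1) closed assms)
  also have "\<dots> = x" using t by simp
  finally show ?thesis by (simp only: t ginv_right_unit assms)
qed

end

text \<open>The image satisfies the defining equations of an inverse, which is unique. This
  naturality makes pointwise inversion an implicit operation.\<close>

lemma sg_hom_ginv:
  assumes "CS S" "CS T" "sg_hom S T h" and x: "x \<in> carr S"
  shows "h (cs.ginv S x) = cs.ginv T (h x)"
proof -
  interpret S: cs S by (rule cs.intro) fact
  interpret T: cs T by (rule cs.intro) fact
  have h: "\<And>x. x \<in> carr S \<Longrightarrow> h x \<in> carr T"
    "\<And>x y. x \<in> carr S \<Longrightarrow> y \<in> carr S \<Longrightarrow> mul T (h x) (h y) = h (mul S x y)"
    using assms(3) by (auto simp: sg_hom_def)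
  have "T.is_inv (h x) (h (S.ginv x))"
    using S.is_inv_ginv[OF x] x unfolding T.is_inv_def S.is_inv_def
    by (metis h S.closed)
  then show ?thesis using T.ginv_eq x h by metis
qed

section \<open>Implicit operations\<close>

definition io_proj :: "nat set \<Rightarrow> nat \<Rightarrow> io" where
  "io_proj A a = (\<lambda>S f. if coord A S f then f a else undefined)"

definition io_inv :: "nat set \<Rightarrow> io \<Rightarrow> io" where
  "io_inv A u = (\<lambda>S f. if coord A S f then cs.ginv S (u S f) else undefined)"

lemma coord_cs: "coord A S f \<Longrightarrow> cs S"
  by (simp add: coord_def cs_def)

lemma coord_hom:
  "coord A S f \<Longrightarrow> CS T \<Longrightarrow> sg_hom S T h \<Longrightarrow> coord A T (restrict (h \<circ> f) A)"
  by (auto simp: coord_def sg_hom_def)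

lemma Omega_carr: "u \<in> Omega A \<Longrightarrow> coord A S f \<Longrightarrow> u S f \<in> carr S"
  unfolding Omega_def by blast

lemma Omega_undefined: "u \<in> Omega A \<Longrightarrow> \<not> coord A S f \<Longrightarrow> u S f = undefined"
  unfolding Omega_def by blast

lemma Omega_hom:
  "u \<in> Omega A \<Longrightarrow> coord A S f \<Longrightarrow> CS T \<Longrightarrow> sg_hom S T h \<Longrightarrow>
    h (u S f) = u T (restrict (h \<circ> f) A)"
  unfolding Omega_def by blast

lemma OmegaI:
  assumes "\<And>S f. coord A S f \<Longrightarrow> u S f \<in> carr S"
    and "\<And>S f. \<not> coord A S f \<Longrightarrow> u S f = undefined"
    and "\<And>S T f h. coord A S f \<Longrightarrow> CS T \<Longrightarrow> sg_hom S T h \<Longrightarrow>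
      h (u S f) = u T (restrict (h \<circ> f) A)"
  shows "u \<in> Omega A"
  unfolding Omega_def using assms by blast

lemma Omega_ext:
  assumes "u \<in> Omega A" "v \<in> Omega A" "\<And>S f. coord A S f \<Longrightarrow> u S f = v S f"
  shows "u = v"
  using assms Omega_undefined by (intro ext) metis

lemma io_proj_Omega [simp]: "a \<in> A \<Longrightarrow> io_proj A a \<in> Omega A"
  by (rule OmegaI) (auto simp: io_proj_def coord_hom, auto simp: coord_def)

lemma io_mult_Omega [simp]:
  assumes "u \<in> Omega A" "v \<in> Omega A"
  shows "io_mult A u v \<in> Omega A"
proof (rule OmegaI)
  fix S T f h assume *: "coord A S f" "CS T" "sg_hom S T h"
  then show "h (io_mult A u v S f) = io_mult A u v T (restrict (h \<circ> f) A)"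
    using assms coord_hom[OF *] Omega_carr[OF _ *(1)] Omega_hom[OF _ *]
    by (simp add: io_mult_def sg_hom_def)
qed (use assms Omega_carr cs.closed coord_cs in \<open>auto simp: io_mult_def\<close>)

lemma io_inv_Omega [simp]:
  assumes "u \<in> Omega A"
  shows "io_inv A u \<in> Omega A"
proof (rule OmegaI)
  fix S T f h assume *: "coord A S f" "CS T" "sg_hom S T h"
  then have "h (cs.ginv S (u S f)) = cs.ginv T (h (u S f))"
    using Omega_carr[OF assms *(1)] by (intro sg_hom_ginv) (auto simp: coord_def)
  then show "h (io_inv A u S f) = io_inv A u T (restrict (h \<circ> f) A)"
    using * coord_hom[OF *] Omega_hom[OF assms *] by (simp add: io_inv_def)
qed (use assms Omega_carr cs.ginv_closed coord_cs in \<open>auto simp: io_inv_def\<close>)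

lemma io_mult_assoc:
  assumes "u \<in> Omega A" "v \<in> Omega A" "w \<in> Omega A"
  shows "io_mult A (io_mult A u v) w = io_mult A u (io_mult A v w)"
  using assms Omega_carr cs.assoc coord_cs
  by (intro ext) (auto simp: io_mult_def)

lemma agree_refl [simp]: "agree F u u"
  and agree_sym: "agree F u v \<Longrightarrow> agree F v u"
  and agree_trans: "agree F u v \<Longrightarrow> agree F v w \<Longrightarrow> agree F u w"
  and agree_mono: "agree F u v \<Longrightarrow> G \<subseteq> F \<Longrightarrow> agree G u v"
  by (auto simp: agree_def)

lemma agree_mult:
  "agree F u u' \<Longrightarrow> agree F v v' \<Longrightarrow> agree F (io_mult A u v) (io_mult A u' v')"
  by (simp add: agree_def io_mult_def)

text \<open>The tuples lie in a finite product of finite carriers; this is why agreement on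
  \<open>F\<close> has finite index.\<close>

lemma finite_tuples:
  assumes "finite F" "\<And>p. p \<in> F \<Longrightarrow> coord A (fst p) (snd p)" "X \<subseteq> Omega A"
  shows "finite ((\<lambda>t. \<lambda>p\<in>F. t (fst p) (snd p)) ` X)"
proof (rule finite_subset)
  show "(\<lambda>t. \<lambda>p\<in>F. t (fst p) (snd p)) ` X \<subseteq> (\<Pi>\<^sub>E p\<in>F. carr (fst p))"
    using assms Omega_carr by (auto simp: subset_iff)
  show "finite (\<Pi>\<^sub>E p\<in>F. carr (fst p))"
    using assms by (intro finite_PiE) (auto simp: coord_def CS_def)
qed

section \<open>Density of words in the free pro-\<open>CS\<close> semigroup\<close>

inductive_set words :: "nat set \<Rightarrow> io set" for A where
  proj: "a \<in> A \<Longrightarrow> io_proj A a \<in> words A"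
| mult: "u \<in> words A \<Longrightarrow> v \<in> words A \<Longrightarrow> io_mult A u v \<in> words A"

lemma words_Omega: "t \<in> words A \<Longrightarrow> t \<in> Omega A"
  by (induction rule: words.induct) auto

text \<open>A two-element left zero semigroup has an automorphism without fixed points.\<close>

lemma Omega_empty: "Omega {} = {}"
proof (rule equals0I)
  fix u assume u: "u \<in> Omega {}"
  obtain T and \<pi> :: "bool \<Rightarrow> nat" where T: "CS T" "carr T = \<pi> ` UNIV"
    "\<And>x y. x \<in> UNIV \<Longrightarrow> y \<in> UNIV \<Longrightarrow> \<pi> x = mul T (\<pi> x) (\<pi> y)"
    "\<And>x y. x \<in> UNIV \<Longrightarrow> y \<in> UNIV \<Longrightarrow> \<pi> x = \<pi> y \<longleftrightarrow> x = y"
    by (rule CS_of_finite_image[of UNIV "\<lambda>x y. x" "\<lambda>x::bool. x"]) auto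
  have c: "coord {} T (\<lambda>_. undefined)" using T by (simp add: coord_def)
  define h where "h n = \<pi> (n \<noteq> \<pi> True)" for n
  have h: "sg_hom T T h" using T by (auto simp: sg_hom_def h_def)
  have "h (u T (\<lambda>_. undefined)) = u T (\<lambda>_. undefined)"
    using Omega_hom[OF u c T(1) h] by (simp add: restrict_def)
  moreover have "u T (\<lambda>_. undefined) \<in> carr T" using u c by (rule Omega_carr)
  ultimately show False using T by (auto simp: h_def)
qed

text \<open>The value tuples of words on \<open>F\<close> form a finite completely simple semigroup
  \<open>T\<close>. Evaluating \<open>w\<close> at \<open>T\<close> on the tuples of the letters
  yields the tuple of some word \<open>t\<close>, and the projections of \<open>T\<close> to the
  coordinates, being homomorphisms, force \<open>w\<close> and \<open>t\<close> to agree.\<close>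

lemma words_dense:
  assumes w: "w \<in> Omega A" and "finite F"
  obtains t where "t \<in> words A" "agree F w t"
proof -
  \<comment> \<open>At the other members of \<open>F\<close> every implicit operation is
    \<open>undefined\<close>, so only genuine coordinates have to be matched.\<close>
  define F' where "F' = {p\<in>F. coord A (fst p) (snd p)}"
  have F': "finite F'" "\<And>p. p \<in> F' \<Longrightarrow> coord A (fst p) (snd p)"
    using \<open>finite F\<close> by (auto simp: F'_def)
  define tup :: "io \<Rightarrow> _" where "tup t = (\<lambda>p\<in>F'. t (fst p) (snd p))" for t
  have tup_eq: "tup s = tup t \<longleftrightarrow> (\<forall>p\<in>F'. s (fst p) (snd p) = t (fst p) (snd p))" for s t
    by (auto simp: tup_def fun_eq_iff)
  have fin: "finite (tup ` words A)"
    using finite_tuples[OF F', of "words A"] words_Omega by (auto simp: tup_def)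
  have div: "\<exists>s\<in>words A. tup (io_mult A x (io_mult A y (io_mult A s (io_mult A y x)))) = tup x"
    if x: "x \<in> words A" and y: "y \<in> words A" for x y
  proof -
    txt \<open>The words need not contain inverses, but \<open>d \<mapsto> xydyx\<close> is an injective self-map of the finite
      set \<open>D\<close> of tuples of words lying in \<open>xSx\<close>, so \<open>x\<close> is in its range.\<close>
    define D where "D = {d \<in> tup ` words A. \<forall>p\<in>F'. \<exists>s\<in>carr (fst p).
      d p = mul (fst p) (x (fst p) (snd p)) (mul (fst p) s (x (fst p) (snd p)))}"
    define r where "r d = (\<lambda>p\<in>F'. mul (fst p) (x (fst p) (snd p)) (mul (fst p) (y (fst p) (snd p))
      (mul (fst p) (d p) (mul (fst p) (y (fst p) (snd p)) (x (fst p) (snd p))))))" for d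
    have r_tup: "r (tup s) = tup (io_mult A x (io_mult A y (io_mult A s (io_mult A y x))))" for s
      using F'(2) by (auto simp: r_def tup_def fun_eq_iff io_mult_def)
    note in_carr = Omega_carr[OF words_Omega[OF x] F'(2)] Omega_carr[OF words_Omega[OF y] F'(2)]
    have tup_carr: "d p \<in> carr (fst p)" if "d \<in> tup ` words A" "p \<in> F'" for d p
      using that Omega_carr[OF words_Omega F'(2)[OF that(2)]] by (auto simp: tup_def)
    have "r ` D \<subseteq> D"
    proof
      fix e assume "e \<in> r ` D"
      then obtain d where d: "d \<in> D" "e = r d" by auto
      then have "e \<in> tup ` words A" using r_tup x y by (auto simp: D_def intro!: imageI words.mult)
      moreover have "\<exists>s\<in>carr (fst p).
        e p = mul (fst p) (x (fst p) (snd p)) (mul (fst p) s (x (fst p) (snd p)))"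
        if p: "p \<in> F'" for p
      proof -
        interpret cs "fst p" using F'(2)[OF p] by (rule coord_cs)
        have "d p \<in> carr (fst p)" using d p tup_carr by (auto simp: D_def)
        then show ?thesis using in_carr[OF p] p
          by (intro bexI[of _ "mul (fst p) (y (fst p) (snd p))
              (mul (fst p) (d p) (y (fst p) (snd p)))"])
            (simp_all add: d r_def)
      qed
      ultimately show "e \<in> D" by (auto simp: D_def)
    qed
    moreover have "inj_on r D"
    proof (rule inj_onI)
      fix d d' assume d: "d \<in> D" and d': "d' \<in> D" and eq: "r d = r d'"
      have "d p = d' p" if p: "p \<in> F'" for p
      proof -
        interpret cs "fst p" using F'(2)[OF p] by (rule coord_cs)
        let ?m = "mul (fst p)" and ?x = "x (fst p) (snd p)" and ?y = "y (fst p) (snd p)"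
        note [simp] = in_carr[OF p]
        \<comment> \<open>\<open>a\<close> and \<open>b\<close> turn \<open>x y x\<close> back into
          \<open>x\<close> from the left and from the right. For \<open>c = x s x\<close> one has
          \<open>r c = x y x s x y x\<close>, so multiplying by them recovers
          \<open>c\<close>.\<close>
        obtain a where a: "a \<in> carr (fst p)" "?m a (?m (?m ?x ?y) ?x) = ?x"
          using left_divE[of ?x "?m ?x ?y"] by auto
        obtain b where b: "b \<in> carr (fst p)" "?m ?x (?m (?m ?y ?x) b) = ?x"
          using right_divE[of ?x "?m ?y ?x"] by auto
        have cancel: "?m a (?m (r c p) b) = c p" if "c \<in> D" for c
        proof -
          obtain s where s: "s \<in> carr (fst p)" and c: "c p = ?m ?x (?m s ?x)"
            using \<open>c \<in> D\<close> p by (auto simp: D_def)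
          have "?m a (?m (r c p) b) = ?m (?m a (?m (?m ?x ?y) ?x)) (?m s (?m ?x (?m (?m ?y ?x) b)))"
            using p a(1) b(1) s by (simp add: r_def c)
          then show ?thesis by (simp only: a b c)
        qed
        show ?thesis using cancel[OF d] cancel[OF d'] eq by simp
      qed
      then show "d = d'" using d d' by (auto simp: D_def tup_def fun_eq_iff)
    qed
    moreover have "finite D" using fin by (simp add: D_def)
    ultimately have "r ` D = D" by (intro endo_inj_surj)
    moreover have "tup x \<in> D"
    proof -
      have "\<exists>s\<in>carr (fst p). tup x p =
        mul (fst p) (x (fst p) (snd p)) (mul (fst p) s (x (fst p) (snd p)))" if p: "p \<in> F'" for p
      proof -
        interpret cs "fst p" using F'(2)[OF p] by (rule coord_cs)
        show ?thesis using in_carr[OF p] p ginv_cancel(1)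
          by (intro bexI[of _ "ginv (x (fst p) (snd p))"]) (simp_all add: tup_def)
      qed
      then show ?thesis using x by (simp add: D_def)
    qed
    ultimately obtain d where "d \<in> D" "r d = tup x" by (metis imageE)
    then show ?thesis using r_tup by (auto simp: D_def)
  qed
  have "A \<noteq> {}" using w Omega_empty by auto
  then have ne: "words A \<noteq> {}" using words.proj by auto
  obtain T \<pi> where T: "CS T" "carr T = \<pi> ` words A"
    and hom: "\<And>x y. x \<in> words A \<Longrightarrow> y \<in> words A \<Longrightarrow> \<pi> (io_mult A x y) = mul T (\<pi> x) (\<pi> y)"
    and ker: "\<And>x y. x \<in> words A \<Longrightarrow> y \<in> words A \<Longrightarrow> \<pi> x = \<pi> y \<longleftrightarrow> tup x = tup y"
  proof (rule CS_of_finite_image[of "words A" "io_mult A" tup, OF ne words.mult fin _ _ div])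
    fix x x' y y' assume "tup x = tup x'" "tup y = tup y'"
    then show "tup (io_mult A x y) = tup (io_mult A x' y')" by (simp add: tup_eq io_mult_def)
  qed (auto simp: io_mult_assoc words_Omega)
  define g where "g = (\<lambda>a\<in>A. \<pi> (io_proj A a))"
  have g: "coord A T g" using T words.proj by (auto simp: coord_def g_def)
  have "w T g \<in> \<pi> ` words A" using Omega_carr[OF w g] T by simp
  then obtain t where t: "t \<in> words A" "w T g = \<pi> t" by auto
  have "w (fst p) (snd p) = t (fst p) (snd p)" if p: "p \<in> F'" for p
  proof -
    \<comment> \<open>\<open>h\<close> reads coordinate \<open>p\<close> off a word representing
      \<open>n\<close>; words with the same image under \<open>\<pi>\<close> have the same tuple, so
      the choice is immaterial.\<close>
    define h where "h n = (SOME s. s \<in> words A \<and> \<pi> s = n) (fst p) (snd p)" for n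
    have h: "h (\<pi> s) = s (fst p) (snd p)" if "s \<in> words A" for s
    proof -
      have "(SOME s'. s' \<in> words A \<and> \<pi> s' = \<pi> s) \<in> words A \<and>
        \<pi> (SOME s'. s' \<in> words A \<and> \<pi> s' = \<pi> s) = \<pi> s"
        by (rule someI[of _ s]) (use that in simp)
      then show ?thesis using that p ker by (auto simp: h_def tup_eq)
    qed
    have c: "coord A (fst p) (snd p)" using F'(2) p by simp
    have "sg_hom T (fst p) h"
      using c h T hom words.mult Omega_carr[OF words_Omega c]
      by (auto simp: sg_hom_def hom[symmetric] io_mult_def)
    then have "h (w T g) = w (fst p) (restrict (h \<circ> g) A)"
      using c by (intro Omega_hom[OF w g]) (auto simp: coord_def)
    moreover have "restrict (h \<circ> g) A = snd p"
    proof
      fix a show "restrict (h \<circ> g) A a = snd p a"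
        using c h[OF words.proj, of a] by (auto simp: g_def io_proj_def coord_def PiE_def extensional_def)
    qed
    ultimately show ?thesis using t h by simp
  qed
  then have "agree F w t"
    using Omega_undefined[OF w] Omega_undefined[OF words_Omega[OF t(1)]]
    by (auto simp: agree_def F'_def) metis
  then show thesis using that t by blast
qed

section \<open>Continuous homomorphisms and substitutions\<close>

text \<open>Both sides agree on words by induction, and near \<open>w\<close> both depend on
  finitely many coordinates, so density finishes. Thus a continuous homomorphism is determined by
  its values on the projections.\<close>

lemma cont_hom_to_eval:
  assumes \<psi>: "cont_hom_to B T \<psi>" and T: "CS T" and w: "w \<in> Omega B"
  defines "g \<equiv> \<lambda>b\<in>B. \<psi> (io_proj B b)"
  shows "\<psi> w = w T g"
proof -
  have g: "coord B T g" using \<psi> T by (auto simp: coord_def g_def cont_hom_to_def)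
  obtain G where G: "finite G" "\<And>u'. u' \<in> Omega B \<Longrightarrow> agree G w u' \<Longrightarrow> \<psi> u' = \<psi> w"
    using \<psi> w unfolding cont_hom_to_def by blast
  obtain t where t: "t \<in> words B" "agree (insert (T, g) G) w t"
    using words_dense[OF w, of "insert (T, g) G"] G by auto
  have "\<psi> t = t T g" using t(1)
  proof induction
    case (proj a)
    have "io_proj B a T g = g a" using g by (simp add: io_proj_def)
    moreover have "\<psi> (io_proj B a) = g a" using proj by (simp add: g_def)
    ultimately show ?case by (simp only:)
  next
    case (mult u v)
    then show ?case using \<psi> g words_Omega by (simp add: cont_hom_to_def io_mult_def)
  qed
  moreover have "\<psi> t = \<psi> w" using t words_Omega by (intro G) (auto simp: agree_def)
  ultimately show ?thesis using t by (simp add: agree_def)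
qed

text \<open>For \<open>g\<close> with values in \<open>Omega A\<close>, the continuous homomorphism
  from \<open>Omega B\<close> to \<open>Omega A\<close> extending
  \<open>io_proj B b \<mapsto> g b\<close>.\<close>

definition subst :: "nat set \<Rightarrow> nat set \<Rightarrow> (nat \<Rightarrow> io) \<Rightarrow> io \<Rightarrow> io" where
  "subst B A g u = (\<lambda>S f. if coord A S f then u S (\<lambda>b\<in>B. g b S f) else undefined)"

lemma coord_subst:
  assumes "\<And>b. b \<in> B \<Longrightarrow> g b \<in> Omega A" "coord A S f"
  shows "coord B S (\<lambda>b\<in>B. g b S f)"
  using Omega_carr[OF assms(1) assms(2)] assms(2) by (simp add: coord_def)

lemma subst_proj:
  assumes "\<And>b. b \<in> B \<Longrightarrow> g b \<in> Omega A" "b \<in> B"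
  shows "subst B A g (io_proj B b) = g b"
proof (intro ext)
  fix S f show "subst B A g (io_proj B b) S f = g b S f"
    using assms coord_subst[of B g A S f] Omega_undefined[of "g b" A S f]
    by (auto simp: subst_def io_proj_def)
qed

lemma cont_hom_subst:
  assumes g: "\<And>b. b \<in> B \<Longrightarrow> g b \<in> Omega A"
  shows "cont_hom B A (subst B A g)"
  unfolding cont_hom_def
proof (intro conjI ballI allI impI)
  fix u assume u: "u \<in> Omega B"
  show "subst B A g u \<in> Omega A"
  proof (rule OmegaI)
    fix S T f h assume *: "coord A S f" "CS T" "sg_hom S T h"
    have "h (u S (\<lambda>b\<in>B. g b S f)) = u T (restrict (h \<circ> (\<lambda>b\<in>B. g b S f)) B)"
      by (rule Omega_hom[OF u coord_subst[of B g A, OF g *(1)] *(2,3)])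
    also have "restrict (h \<circ> (\<lambda>b\<in>B. g b S f)) B = (\<lambda>b\<in>B. g b T (restrict (h \<circ> f) A))"
      using Omega_hom[OF g *] by (auto simp: fun_eq_iff)
    finally show "h (subst B A g u S f) = subst B A g u T (restrict (h \<circ> f) A)"
      using * coord_hom[OF *] by (simp add: subst_def del: restrict_apply)
  qed (use Omega_carr[OF u coord_subst[of B g A, OF g]] in \<open>auto simp: subst_def\<close>)
  fix F :: "(sg \<times> (nat \<Rightarrow> nat)) set" assume "finite F"
  \<comment> \<open>The value of the image at a coordinate depends on a single coordinate of the
    argument, so \<open>F\<close> is pulled back pointwise.\<close>
  then show "\<exists>G. finite G \<and> (\<forall>u'\<in>Omega B. agree G u u' \<longrightarrow> agree F (subst B A g u) (subst B A g u'))"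
    by (intro exI[of _ "(\<lambda>p. (fst p, \<lambda>b\<in>B. g b (fst p) (snd p))) ` F"])
      (auto simp: agree_def subst_def)
next
  fix u v
  show "subst B A g (io_mult B u v) = io_mult A (subst B A g u) (subst B A g v)"
    using coord_subst[of B g A, OF g] by (auto simp: fun_eq_iff subst_def io_mult_def)
qed

section \<open>Closed congruences\<close>

text \<open>Green's relation \<open>H\<close> in every coordinate. Divisibility is recorded in one
  direction, which in a completely simple semigroup entails the other.\<close>

definition H_related :: "nat set \<Rightarrow> io \<Rightarrow> io \<Rightarrow> bool" where
  "H_related A w v \<longleftrightarrow> (\<forall>S f. coord A S f \<longrightarrow>
    (\<exists>s\<in>carr S. v S f = mul S (w S f) s) \<and> (\<exists>s\<in>carr S. v S f = mul S s (w S f)))"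

text \<open>The coordinate is the free rectangular band \<open>A \<times> A\<close>, which records the first and the last
  letter of a word.\<close>

lemma ex_H_coord:
  assumes "finite A" "A \<noteq> {}"
  shows "\<exists>R c. coord A R c \<and>
    (\<forall>w\<in>Omega A. \<forall>v\<in>Omega A. w R c = v R c \<longrightarrow> H_related A w v)"
proof -
  define m :: "nat \<times> nat \<Rightarrow> nat \<times> nat \<Rightarrow> nat \<times> nat" where "m x y = (fst x, snd y)" for x y
  obtain R \<pi> where R: "CS R" "carr R = \<pi> ` (A \<times> A)"
    and hom: "\<And>x y. x \<in> A \<times> A \<Longrightarrow> y \<in> A \<times> A \<Longrightarrow> \<pi> (m x y) = mul R (\<pi> x) (\<pi> y)"
    and inj: "\<And>x y. x \<in> A \<times> A \<Longrightarrow> y \<in> A \<times> A \<Longrightarrow> \<pi> x = \<pi> y \<longleftrightarrow> x = y"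
  proof (rule CS_of_finite_image[of "A \<times> A" m "\<lambda>x. x"])
    show "\<exists>s\<in>A \<times> A. m x (m y (m s (m y x))) = x" if "x \<in> A \<times> A" for x y
      using that by (intro bexI[of _ x]) (simp_all add: m_def)
  qed (use assms in \<open>simp_all add: m_def mem_Times_iff\<close>)
  define c where "c = (\<lambda>a\<in>A. \<pi> (a, a))"
  have c: "coord A R c" using R by (simp add: coord_def c_def)
  \<comment> \<open>\<open>a\<close> and \<open>b\<close> are the first and last letters of
    \<open>t\<close>; the multipliers absorb the rest of the word.\<close>
  have letters: "\<exists>a\<in>A. \<exists>b\<in>A. t R c = \<pi> (a, b) \<and>
      (\<exists>s\<in>carr S. t S f = mul S (f a) s) \<and> (\<exists>s\<in>carr S. t S f = mul S s (f b))"
    if "t \<in> words A" and S: "coord A S f" for t S f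
    using that(1)
  proof induction
    case (proj a)
    interpret cs S using S by (rule coord_cs)
    have fa: "f a \<in> carr S" using proj S by (auto simp: coord_def)
    have "\<exists>s\<in>carr S. f a = mul S (f a) s" "\<exists>s\<in>carr S. f a = mul S s (f a)"
      using fa ginv_cancel(1)[OF fa] by (metis closed ginv_closed assoc)+
    moreover have "c a = \<pi> (a, a)" using proj by (simp add: c_def)
    then have "io_proj A a R c = \<pi> (a, a)" "io_proj A a S f = f a"
      using c S by (simp_all add: io_proj_def)
    ultimately show ?case using proj by auto
  next
    case (mult u v)
    interpret cs S using S by (rule coord_cs)
    have uv: "u S f \<in> carr S" "v S f \<in> carr S" using Omega_carr[OF words_Omega S] mult.hyps by auto
    obtain a b s where u: "a \<in> A" "b \<in> A" "u R c = \<pi> (a, b)" "s \<in> carr S" "u S f = mul S (f a) s"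
      using mult.IH(1) by blast
    obtain a' b' s' where v: "a' \<in> A" "b' \<in> A" "v R c = \<pi> (a', b')" "s' \<in> carr S" "v S f = mul S s' (f b')"
      using mult.IH(2) by blast
    have f: "f a \<in> carr S" "f b' \<in> carr S" using u v S by (auto simp: coord_def)
    have "io_mult A u v R c = \<pi> (a, b')" using u v c hom[of "(a, b)" "(a', b')"]
      by (simp add: io_mult_def m_def)
    moreover have "io_mult A u v S f = mul S (f a) (mul S s (v S f))"
      using S u uv f by (simp add: io_mult_def)
    moreover have "io_mult A u v S f = mul S (mul S (u S f) s') (f b')"
      using S v uv f by (simp add: io_mult_def)
    ultimately show ?case using u(1,4) v(2,4) uv by (meson closed)
  qed
  have "(\<exists>s\<in>carr S. v S f = mul S (w S f) s) \<and> (\<exists>s\<in>carr S. v S f = mul S s (w S f))"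
    if w: "w \<in> Omega A" and v: "v \<in> Omega A" and eq: "w R c = v R c" and S: "coord A S f" for w v S f
  proof -
    interpret cs S using S by (rule coord_cs)
    have *: "\<exists>a\<in>A. \<exists>b\<in>A. x R c = \<pi> (a, b) \<and>
      (\<exists>s\<in>carr S. x S f = mul S (f a) s) \<and> (\<exists>s\<in>carr S. x S f = mul S s (f b))" if "x \<in> Omega A" for x
    proof -
      obtain t where "t \<in> words A" "agree {(R, c), (S, f)} x t"
        using words_dense[OF \<open>x \<in> Omega A\<close>, of "{(R, c), (S, f)}"] by auto
      then show ?thesis using letters[OF _ S, of t] by (simp add: agree_def)
    qed
    obtain a b s t where ab: "a \<in> A" "b \<in> A" "w R c = \<pi> (a, b)"
      and s: "s \<in> carr S" "w S f = mul S (f a) s" and t: "t \<in> carr S" "w S f = mul S t (f b)"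
      using *[OF w] by blast
    obtain a' b' s' t' where ab': "a' \<in> A" "b' \<in> A" "v R c = \<pi> (a', b')"
      and s': "s' \<in> carr S" "v S f = mul S (f a') s'" and t': "t' \<in> carr S" "v S f = mul S t' (f b')"
      using *[OF v] by blast
    have [simp]: "a' = a" "b' = b" using inj[of "(a, b)" "(a', b')"] ab ab' eq by auto
    have f: "f a \<in> carr S" "f b \<in> carr S" using ab S by (auto simp: coord_def)
    \<comment> \<open>Dividing back recovers \<open>f a\<close> and \<open>f b\<close> from
      \<open>w\<close>. As \<open>v\<close> has the same first and last letters, \<open>w\<close>
      divides it on both sides.\<close>
    obtain q where "q \<in> carr S" "mul S (f a) (mul S s q) = f a" using right_divE[OF f(1) s(1)] .
    moreover obtain q' where "q' \<in> carr S" "mul S q' (mul S t (f b)) = f b" using left_divE[OF f(2) t(1)] .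
    ultimately have q: "q \<in> carr S" "f a = mul S (w S f) q" and q': "q' \<in> carr S" "f b = mul S q' (w S f)"
      using f s t by auto
    have w': "w S f \<in> carr S" using w S by (rule Omega_carr)
    have "v S f = mul S (w S f) (mul S q s')" using s' q w' by (metis assoc \<open>a' = a\<close>)
    moreover have "v S f = mul S (mul S t' q') (w S f)" using t' q' w' by (metis assoc \<open>b' = b\<close>)
    ultimately show ?thesis using q q' s' t' closed by blast
  qed
  then have "\<forall>w\<in>Omega A. \<forall>v\<in>Omega A. w R c = v R c \<longrightarrow> H_related A w v"
    unfolding H_related_def by blast
  with c show ?thesis by blast
qed

lemma agree_coord:
  assumes "u \<in> Omega A" "v \<in> Omega A"
  shows "agree {p\<in>F. coord A (fst p) (snd p)} u v \<longleftrightarrow> agree F u v"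
  using assms Omega_undefined unfolding agree_def by (metis (mono_tags, lifting) mem_Collect_eq)

section \<open>Finite quotients by closed congruences\<close>

text \<open>Provability enters the separation argument through these properties alone;
  \<open>E_closed\<close> is closedness in the product topology.\<close>

locale closed_cong =
  fixes A :: "nat set" and E :: "io \<Rightarrow> io \<Rightarrow> bool"
  assumes finite_A: "finite A"
    and E_Omega: "E u v \<Longrightarrow> u \<in> Omega A \<and> v \<in> Omega A"
    and E_refl: "u \<in> Omega A \<Longrightarrow> E u u"
    and E_sym: "E u v \<Longrightarrow> E v u"
    and E_trans [trans]: "E u v \<Longrightarrow> E v w \<Longrightarrow> E u w"
    and E_mult: "E u u' \<Longrightarrow> E v v' \<Longrightarrow> E (io_mult A u v) (io_mult A u' v')"
    and E_closed: "u \<in> Omega A \<Longrightarrow> v \<in> Omega A \<Longrightarrow>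
      (\<And>F. finite F \<Longrightarrow> \<exists>u' v'. E u' v' \<and> agree F u u' \<and> agree F v v') \<Longrightarrow> E u v"
begin

abbreviation io_times (infixl "\<bullet>" 70) where "x \<bullet> y \<equiv> io_mult A x y"

text \<open>\<open>E\<close> is assumed to respect products, not inverses; this controls the
  inverses that occur. Multiplying \<open>k \<sim> k k\<close> by the inverse \<open>i\<close> gives
  \<open>i k \<sim> k\<close>, and a further factor \<open>i\<close> gives
  \<open>i = i i k \<sim> i k\<close>.\<close>

lemma E_inv_idem:
  assumes "E k (k \<bullet> k)"
  shows "E (io_inv A k) k"
proof -
  have [simp]: "k \<in> Omega A" using E_Omega assms by blast
  let ?i = "io_inv A k"
  have 1: "?i \<bullet> (k \<bullet> k) = k" and 2: "?i \<bullet> (?i \<bullet> k) = ?i"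
    by (rule Omega_ext[where A = A], simp_all, simp add: io_mult_def io_inv_def
        cs.ginv_mult_square coord_cs Omega_carr[of k A])+
  have ik: "E (?i \<bullet> k) k" using E_mult[OF E_refl assms, of ?i] 1 by simp
  then have "E (?i \<bullet> (?i \<bullet> k)) (?i \<bullet> k)" by (intro E_mult E_refl) auto
  then have "E ?i (?i \<bullet> k)" by (simp only: 2)
  also note ik
  finally show ?thesis .
qed

text \<open>The Mal'cev-like term \<open>p(u, w, v) = u (zu)\<^sup>-\<^sup>1 z v z u\<close> with \<open>z = w\<^sup>-\<^sup>1\<close> satisfies
  \<open>p(u, w, w) = u\<close> always and \<open>p(w, w, v) = v\<close> whenever \<open>w\<close> and \<open>v\<close> are \<open>H\<close>-related.\<close>

lemma E_agree_permute:
  assumes uw: "E u w" and v: "v \<in> Omega A" and agree: "agree F w v"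
    and H: "H_related A w v"
  obtains w' where "E w' v" "agree F w' u"
proof -
  have [simp]: "u \<in> Omega A" "w \<in> Omega A" "v \<in> Omega A" using E_Omega uw v by auto
  define z where "z = io_inv A w"
  have z [simp]: "z \<in> Omega A" by (simp add: z_def)
  define p where "p x y = x \<bullet> (io_inv A (z \<bullet> x) \<bullet> (z \<bullet> (y \<bullet> (z \<bullet> x))))" for x y
  have pu: "p u w = u"
    by (rule Omega_ext[where A = A]) (simp_all add: p_def, simp add: z_def io_mult_def io_inv_def
        cs.malcev_right coord_cs Omega_carr[of u A] Omega_carr[of w A])
  have pw: "p w v = v"
  proof (rule Omega_ext[where A = A])
    fix S f assume c: "coord A S f"
    obtain s t where "s \<in> carr S" "v S f = mul S (w S f) s" "t \<in> carr S" "v S f = mul S t (w S f)"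
      using H c unfolding H_related_def by blast
    then show "p w v S f = v S f"
      using c cs.malcev_left[OF coord_cs[OF c], of "w S f" s "v S f" t] Omega_carr[of w A]
      by (simp add: p_def z_def io_mult_def io_inv_def)
  qed (simp_all add: p_def)
  \<comment> \<open>\<open>z w\<close> is idempotent and \<open>z u\<close> is congruent to it, so
    each is congruent to its own inverse. Hence the inverses inside \<open>p u v\<close> and
    \<open>p w v\<close> are congruent.\<close>
  have zw: "z \<bullet> w \<bullet> (z \<bullet> w) = z \<bullet> w"
    by (rule Omega_ext[where A = A]) (simp_all, simp add: z_def io_mult_def io_inv_def
        cs.ginv_mult_idem coord_cs Omega_carr[of w A])
  have k: "E (z \<bullet> u) (z \<bullet> w)" using uw by (intro E_mult E_refl z)
  then have "E (z \<bullet> u \<bullet> (z \<bullet> u)) (z \<bullet> w)" using E_mult[OF k k] zw by simp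
  then have "E (z \<bullet> u) (z \<bullet> u \<bullet> (z \<bullet> u))" using k E_sym E_trans by blast
  then have iu: "E (io_inv A (z \<bullet> u)) (z \<bullet> u)" by (rule E_inv_idem)
  have "E (io_inv A (z \<bullet> w)) (z \<bullet> w)"
    using zw by (intro E_inv_idem) (simp add: E_refl)
  then have "E (io_inv A (z \<bullet> u)) (io_inv A (z \<bullet> w))" using iu k E_sym E_trans by blast
  \<comment> \<open>The witness is \<open>p u v\<close>: congruent to \<open>p w v = v\<close>, and
    agreeing on \<open>F\<close> with \<open>p u w = u\<close> because the second argument of
    \<open>p\<close> stays outside the inverse.\<close>
  then have "E (p u v) (p w v)"
    unfolding p_def using uw k v z by (intro E_mult E_refl)
  moreover have "agree F (p u v) (p u w)"
    unfolding p_def by (intro agree_mult agree_refl agree_sym[OF agree])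
  ultimately show thesis using that pu pw by simp
qed

text \<open>Closedness gives a finite \<open>F\<close> on which no pair of \<open>E\<close>
  approximates \<open>(u, v)\<close>. Once the rectangular band coordinate is added, composing
  \<open>E\<close> with agreement yields a congruence of finite index that still separates
  \<open>u\<close> from \<open>v\<close>.\<close>

lemma separating_quotient:
  assumes u: "u \<in> Omega A" and v: "v \<in> Omega A" and "\<not> E u v"
  obtains T \<pi> where "CS T" "carr T = \<pi> ` Omega A" "cont_hom_to A T \<pi>"
    "\<And>x y. E x y \<Longrightarrow> \<pi> x = \<pi> y" "\<pi> u \<noteq> \<pi> v"
proof -
  have "A \<noteq> {}" using u Omega_empty by auto
  then obtain R c where R: "coord A R c"
    and H: "\<forall>w\<in>Omega A. \<forall>v\<in>Omega A. w R c = v R c \<longrightarrow> H_related A w v"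
    using ex_H_coord[OF finite_A] by blast
  obtain F where F: "finite F" "\<And>u' v'. E u' v' \<Longrightarrow> agree F u u' \<Longrightarrow> \<not> agree F v v'"
    using E_closed[OF u v] \<open>\<not> E u v\<close> by blast
  define G where "G = insert (R, c) {p\<in>F. coord A (fst p) (snd p)}"
  have G: "finite G" "\<And>p. p \<in> G \<Longrightarrow> coord A (fst p) (snd p)"
    using F(1) R by (auto simp: G_def)
  have agree_F: "agree F x y" if "agree G x y" "x \<in> Omega A" "y \<in> Omega A" for x y
  proof -
    have "agree {p\<in>F. coord A (fst p) (snd p)} x y"
      using that(1) by (rule agree_mono) (auto simp: G_def)
    then show ?thesis using agree_coord[OF that(2,3)] by simp
  qed
  have permute: "\<exists>w'. E w' y \<and> agree G w' x"
    if "E x w" "y \<in> Omega A" "agree G w y" for x y w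
  proof -
    have "w R c = y R c" using that by (simp add: agree_def G_def)
    then have "H_related A w y" using H that E_Omega by blast
    from E_agree_permute[OF that this] show ?thesis by blast
  qed
  \<comment> \<open>The composite of \<open>E\<close> and agreement on \<open>G\<close>;
    \<open>permute\<close> supplies symmetry and transitivity.\<close>
  define \<rho> where "\<rho> x y \<longleftrightarrow> y \<in> Omega A \<and> (\<exists>w. E x w \<and> agree G w y)" for x y
  have \<rho>_refl: "\<rho> x x" if "x \<in> Omega A" for x using that E_refl[OF that] agree_refl[of G x] unfolding \<rho>_def by blast
  have \<rho>_sym: "\<rho> y x" if "\<rho> x y" for x y
    using that permute E_Omega E_sym unfolding \<rho>_def by blast
  have \<rho>_trans: "\<rho> x z" if xy: "\<rho> x y" and yz: "\<rho> y z" for x y z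
  proof -
    obtain w w2 where w: "E x w" "agree G w y" "E y w2" "agree G w2 z"
      using xy yz by (auto simp: \<rho>_def)
    obtain w' where "E w' w" "agree G w' w2"
      using permute[of w2 y w] w E_sym agree_sym E_Omega by blast
    then have "E x w'" "agree G w' z" using w E_sym E_trans agree_trans by blast+
    then show ?thesis using yz by (auto simp: \<rho>_def)
  qed
  have \<rho>_mult: "\<rho> (x \<bullet> y) (x' \<bullet> y')" if "\<rho> x x'" "\<rho> y y'" for x x' y y'
    using that unfolding \<rho>_def by (meson E_mult agree_mult io_mult_Omega)
  define cl where "cl x = Collect (\<rho> x)" for x
  have cl_eq: "cl x = cl y \<longleftrightarrow> \<rho> x y" if "x \<in> Omega A" "y \<in> Omega A" for x y
  proof
    assume "cl x = cl y"
    then show "\<rho> x y" using \<rho>_refl[OF that(2)] by (auto simp: cl_def)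
  next
    assume "\<rho> x y"
    then show "cl x = cl y" using \<rho>_sym \<rho>_trans unfolding cl_def by blast
  qed
  have cl_agree: "cl x = cl y" if "x \<in> Omega A" "y \<in> Omega A" "agree G x y" for x y
    using that E_refl by (auto simp: cl_eq \<rho>_def)
  define tup :: "io \<Rightarrow> _" where "tup t = (\<lambda>p\<in>G. t (fst p) (snd p))" for t
  have tup_eq: "tup s = tup t \<longleftrightarrow> agree G s t" for s t
    by (auto simp: tup_def agree_def fun_eq_iff)
  \<comment> \<open>A class depends only on the tuple of values on \<open>G\<close>, so there are at
    most as many classes as tuples.\<close>
  have cl_tup: "cl (inv_into (Omega A) tup (tup x)) = cl x" if x: "x \<in> Omega A" for x
  proof -
    let ?y = "inv_into (Omega A) tup (tup x)"
    have "tup ?y = tup x" "?y \<in> Omega A" using x by (simp_all add: f_inv_into_f inv_into_into)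
    then show ?thesis using x cl_agree tup_eq by blast
  qed
  have "cl ` Omega A \<subseteq> (\<lambda>\<tau>. cl (inv_into (Omega A) tup \<tau>)) ` tup ` Omega A"
    using cl_tup by (force simp: image_image)
  moreover have "finite (tup ` Omega A)"
    unfolding tup_def by (rule finite_tuples[OF G]) auto
  ultimately have fin: "finite (cl ` Omega A)" by (meson finite_imageI finite_subset)
  have ne: "Omega A \<noteq> {}" using u by auto
  obtain T \<pi> where T: "CS T" "carr T = \<pi> ` Omega A"
    and hom: "\<And>x y. x \<in> Omega A \<Longrightarrow> y \<in> Omega A \<Longrightarrow> \<pi> (x \<bullet> y) = mul T (\<pi> x) (\<pi> y)"
    and ker: "\<And>x y. x \<in> Omega A \<Longrightarrow> y \<in> Omega A \<Longrightarrow> \<pi> x = \<pi> y \<longleftrightarrow> cl x = cl y"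
  proof (rule CS_of_finite_image[of "Omega A" "io_mult A" cl, OF ne io_mult_Omega fin])
    show "cl (x \<bullet> y) = cl (x' \<bullet> y')"
      if "x \<in> Omega A" "x' \<in> Omega A" "y \<in> Omega A" "y' \<in> Omega A" "cl x = cl x'" "cl y = cl y'"
      for x x' y y' using that \<rho>_mult by (simp add: cl_eq)
    show "\<exists>s\<in>Omega A. cl (x \<bullet> (y \<bullet> (s \<bullet> (y \<bullet> x)))) = cl x"
      if x: "x \<in> Omega A" and y: "y \<in> Omega A" for x y
    proof -
      let ?s = "io_inv A (x \<bullet> y) \<bullet> (x \<bullet> io_inv A (y \<bullet> x))"
      have "x \<bullet> (y \<bullet> (?s \<bullet> (y \<bullet> x))) = x"
        by (rule Omega_ext[where A = A]) (use x y in simp_all, simp add: io_mult_def io_inv_def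
            cs.mult_ginv_absorb cs.assoc cs.ginv_closed cs.closed coord_cs
            Omega_carr[of x A] Omega_carr[of y A])
      then show ?thesis using x y by (intro bexI[of _ ?s]) auto
    qed
  qed (auto simp: io_mult_assoc)
  have "\<pi> x = \<pi> y" if "E x y" for x y
    using that E_Omega[OF that] by (auto simp: ker cl_eq \<rho>_def)
  \<comment> \<open>Otherwise \<open>E u w\<close> for some \<open>w\<close> agreeing with
    \<open>v\<close> on \<open>F\<close>, against the choice of \<open>F\<close>.\<close>
  moreover have "\<not> \<rho> u v"
    using F(2)[of u] agree_F E_Omega agree_sym agree_refl unfolding \<rho>_def by blast
  then have "\<pi> u \<noteq> \<pi> v" using u v by (simp add: ker cl_eq)
  moreover have "cont_hom_to A T \<pi>"
    unfolding cont_hom_to_def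
  proof (intro conjI ballI)
    fix x assume "x \<in> Omega A"
    then show "\<exists>G. finite G \<and> (\<forall>y\<in>Omega A. agree G x y \<longrightarrow> \<pi> y = \<pi> x)"
      using G(1) cl_agree[of x] by (intro exI[of _ G]) (simp add: ker)
  qed (use T hom in auto)
  ultimately show thesis using that T by blast
qed

end

section \<open>Provability\<close>

lemma eval_term_Omega:
  "(\<And>i. env i \<in> Omega A) \<Longrightarrow> eval_term A env t \<in> Omega A"
  by (induction t) auto

section \<open>Contexts and instances\<close>

text \<open>Variable \<open>0\<close> is the hole that receives either side of an instance. The
  other variables move up by one, which frees variable \<open>1\<close> for a new factor.\<close>

fun shift_term :: "sterm \<Rightarrow> sterm" where
  "shift_term (Var i) = Var (if i = 0 then 0 else Suc i)"
| "shift_term (Mul s t) = Mul (shift_term s) (shift_term t)"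

lemma eval_shift_term:
  "eval_term A (\<lambda>i. if i = 0 then x else if i = 1 then w else env (i - 1)) (shift_term t) =
    eval_term A (env(0 := x)) t"
  by (induction t) auto

context
  fixes \<Sigma> :: "(nat set \<times> io \<times> io) set" and A :: "nat set"
  assumes pseudoid: "\<forall>p\<in>\<Sigma>. is_pseudoid p"
begin

definition instances :: "(io \<times> io) set" where
  "instances = {(a, b). \<exists>B u v \<phi>. ((B, u, v) \<in> \<Sigma> \<or> (B, v, u) \<in> \<Sigma>) \<and> cont_hom B A \<phi> \<and>
    a = \<phi> u \<and> b = \<phi> v}"

lemma instancesI:
  "(B, u, v) \<in> \<Sigma> \<Longrightarrow> cont_hom B A \<phi> \<Longrightarrow> (\<phi> u, \<phi> v) \<in> instances"
  unfolding instances_def by blast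

lemma instances_sym: "(a, b) \<in> instances \<Longrightarrow> (b, a) \<in> instances"
  unfolding instances_def by blast

lemma instances_Omega:
  assumes "(a, b) \<in> instances"
  shows "a \<in> Omega A" "b \<in> Omega A"
proof -
  obtain B u v \<phi> where *: "(B, u, v) \<in> \<Sigma> \<or> (B, v, u) \<in> \<Sigma>" "cont_hom B A \<phi>" "a = \<phi> u" "b = \<phi> v"
    using assms unfolding instances_def by blast
  then have "u \<in> Omega B" "v \<in> Omega B" using pseudoid by (auto simp: is_pseudoid_def)
  then show "a \<in> Omega A" "b \<in> Omega A" using *(2-4) by (simp_all add: cont_hom_def)
qed

lemma Sigma0I:
  assumes "(a, b) \<in> instances" "\<And>i. env i \<in> Omega A"
  shows "(eval_term A (env(0 := a)) t, eval_term A (env(0 := b)) t) \<in> Sigma0 \<Sigma> A"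
proof -
  obtain B u v \<phi> where *: "(B, u, v) \<in> \<Sigma> \<or> (B, v, u) \<in> \<Sigma>" "cont_hom B A \<phi>" "a = \<phi> u" "b = \<phi> v"
    using assms(1) unfolding instances_def by blast
  show ?thesis
    unfolding Sigma0_def mem_Collect_eq
    by (rule exI[of _ B], rule exI[of _ u], rule exI[of _ v], rule exI[of _ \<phi>],
        rule exI[of _ env], rule exI[of _ t]) (use * assms(2) in simp)
qed

lemma Sigma0E:
  assumes "(x, y) \<in> Sigma0 \<Sigma> A"
  obtains a b env t where "(a, b) \<in> instances" "\<forall>i. env i \<in> Omega A"
    "x = eval_term A (env(0 := a)) t" "y = eval_term A (env(0 := b)) t"
proof -
  obtain B u v \<phi> env t where *: "(B, u, v) \<in> \<Sigma> \<or> (B, v, u) \<in> \<Sigma>" "cont_hom B A \<phi>"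
    "\<forall>i. env i \<in> Omega A"
    "x = eval_term A (env(0 := \<phi> u)) t" "y = eval_term A (env(0 := \<phi> v)) t"
    using assms unfolding Sigma0_def mem_Collect_eq by (elim exE conjE Pair_inject) (rule that)
  then have "(\<phi> u, \<phi> v) \<in> instances" unfolding instances_def by blast
  then show thesis by (rule that[of "\<phi> u" "\<phi> v" env t]) (use * in simp_all)
qed

lemma Sigma0_sym: "(x, y) \<in> Sigma0 \<Sigma> A \<Longrightarrow> (y, x) \<in> Sigma0 \<Sigma> A"
  by (elim Sigma0E) (simp add: Sigma0I instances_sym)

text \<open>The factor is absorbed into the context: \<open>t\<close> becomes \<open>t w\<close> or
  \<open>w t\<close>, with \<open>w\<close> stored in the freed variable.\<close>

lemma Sigma0_mult:
  assumes xy: "(x, y) \<in> Sigma0 \<Sigma> A" and w: "w \<in> Omega A"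
  shows "(io_mult A x w, io_mult A y w) \<in> Sigma0 \<Sigma> A"
    and "(io_mult A w x, io_mult A w y) \<in> Sigma0 \<Sigma> A"
proof -
  obtain a b env t where *: "(a, b) \<in> instances" "\<forall>i. env i \<in> Omega A"
    "x = eval_term A (env(0 := a)) t" "y = eval_term A (env(0 := b)) t"
    using xy by (rule Sigma0E)
  define env' where "env' i = (if i = 1 then w else env (i - 1))" for i
  have env': "\<And>i. env' i \<in> Omega A" using * w by (simp add: env'_def)
  have upd: "env'(0 := c) = (\<lambda>i. if i = 0 then c else if i = 1 then w else env (i - 1))" for c
    by (auto simp: env'_def)
  show "(io_mult A x w, io_mult A y w) \<in> Sigma0 \<Sigma> A"
    using Sigma0I[of a b env' "Mul (shift_term t) (Var 1)", OF *(1) env']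
    by (simp add: upd eval_shift_term *(3,4) del: fun_upd_apply One_nat_def)
  show "(io_mult A w x, io_mult A w y) \<in> Sigma0 \<Sigma> A"
    using Sigma0I[of a b env' "Mul (Var 1) (shift_term t)", OF *(1) env']
    by (simp add: upd eval_shift_term *(3,4) del: fun_upd_apply One_nat_def)
qed

lemma provable_Omega: "provable \<Sigma> A x y \<Longrightarrow> x \<in> Omega A \<and> y \<in> Omega A"
proof (induction rule: provable.induct)
  case (base u v)
  then obtain a b env t where *: "(a, b) \<in> instances" "\<forall>i. env i \<in> Omega A"
    "u = eval_term A (env(0 := a)) t" "v = eval_term A (env(0 := b)) t"
    by (rule Sigma0E)
  then show ?case using instances_Omega[OF *(1)] by (simp add: eval_term_Omega)
qed auto

lemma provable_sym: "provable \<Sigma> A x y \<Longrightarrow> provable \<Sigma> A y x"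
proof (induction rule: provable.induct)
  case (base u v)
  then show ?case by (rule provable.base[OF Sigma0_sym])
next
  case (trans u v w)
  then show ?case by (blast intro: provable.trans)
next
  case (limit u v)
  then show ?case by (intro provable.limit) blast+
qed

lemma provable_mult1:
  assumes "provable \<Sigma> A x y" and w: "w \<in> Omega A"
  shows "provable \<Sigma> A (io_mult A x w) (io_mult A y w) \<and>
    provable \<Sigma> A (io_mult A w x) (io_mult A w y)"
  using assms(1)
proof (induction rule: provable.induct)
  case (base u v)
  then show ?case using Sigma0_mult[OF _ w] by (blast intro: provable.base)
next
  case (trans u v v')
  then show ?case by (blast intro: provable.trans)
next
  case (limit u v)
  show ?case
  proof (intro conjI provable.limit allI impI)
    fix F :: "(sg \<times> (nat \<Rightarrow> nat)) set" assume "finite F"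
    then obtain u' v' where *: "provable \<Sigma> A (io_mult A u' w) (io_mult A v' w)"
      "provable \<Sigma> A (io_mult A w u') (io_mult A w v')" "agree F u u'" "agree F v v'"
      using limit.IH by blast
    show "\<exists>a b. provable \<Sigma> A a b \<and> agree F (io_mult A u w) a \<and> agree F (io_mult A v w) b"
      by (intro exI[of _ "io_mult A u' w"] exI[of _ "io_mult A v' w"]) (simp add: * agree_mult)
    show "\<exists>a b. provable \<Sigma> A a b \<and> agree F (io_mult A w u) a \<and> agree F (io_mult A w v) b"
      by (intro exI[of _ "io_mult A w u'"] exI[of _ "io_mult A w v'"]) (simp add: * agree_mult)
  qed (use limit w in simp_all)
qed

lemma provable_closed_cong:
  assumes "finite A" "\<Sigma> \<noteq> {}"
  shows "closed_cong A (provable \<Sigma> A)"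
proof
  show "provable \<Sigma> A u u" if u: "u \<in> Omega A" for u
  proof -
    obtain B x y where xy: "(B, x, y) \<in> \<Sigma>" using \<open>\<Sigma> \<noteq> {}\<close> by auto
    \<comment> \<open>Reflexivity comes from the context \<open>Var 1\<close>, which avoids the
      hole. It still takes an instance of some member of \<open>\<Sigma>\<close>, here the one
      sending every generator to \<open>u\<close>.\<close>
    have "cont_hom B A (subst B A (\<lambda>_. u))" using u by (intro cont_hom_subst)
    then show ?thesis
      using Sigma0I[OF instancesI[OF xy], where env = "\<lambda>_. u" and t = "Var 1"] u by (intro provable.base) simp
  qed
  show "provable \<Sigma> A (io_mult A u v) (io_mult A u' v')"
    if "provable \<Sigma> A u u'" "provable \<Sigma> A v v'" for u u' v v'
    using that provable_mult1 provable_Omega by (meson provable.trans)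
  show "provable \<Sigma> A u v" if "u \<in> Omega A" "v \<in> Omega A"
    "\<And>F. finite F \<Longrightarrow> \<exists>u' v'. provable \<Sigma> A u' v' \<and> agree F u u' \<and> agree F v v'" for u v
    using that by (intro provable.limit) auto
qed (use assms provable_Omega provable_sym in \<open>auto intro: provable.trans\<close>)

text \<open>Any continuous homomorphism \<open>\<psi>\<close> into \<open>T\<close> lifts along
  \<open>\<pi>\<close>: choosing preimages of its values on the projections defines a substitution
  \<open>\<phi>\<close> with \<open>\<pi> \<circ> \<phi> = \<psi>\<close>. The two sides of a member
  of \<open>\<Sigma>\<close> become provably equal under \<open>\<phi>\<close>, so
  \<open>\<pi>\<close> identifies them.\<close>

lemma quotient_in_models:
  assumes T: "CS T" "carr T = \<pi> ` Omega A" and \<pi>: "cont_hom_to A T \<pi>"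
    and ker: "\<And>x y. provable \<Sigma> A x y \<Longrightarrow> \<pi> x = \<pi> y"
    and w: "w \<in> Omega A"
  shows "T \<in> models \<Sigma>"
proof -
  have "\<psi> x = \<psi> y" if xy: "(B, x, y) \<in> \<Sigma>" and \<psi>: "cont_hom_to B T \<psi>" for B x y \<psi>
  proof -
    have Omega: "x \<in> Omega B" "y \<in> Omega B" using xy pseudoid by (auto simp: is_pseudoid_def)
    have "\<exists>s\<in>Omega A. \<pi> s = \<psi> (io_proj B b)" if "b \<in> B" for b
    proof -
      have "\<psi> (io_proj B b) \<in> carr T" using \<psi> that by (simp add: cont_hom_to_def)
      then show ?thesis using T by auto
    qed
    then obtain g where g: "\<And>b. b \<in> B \<Longrightarrow> g b \<in> Omega A"
      and \<pi>g: "\<And>b. b \<in> B \<Longrightarrow> \<pi> (g b) = \<psi> (io_proj B b)" by metis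
    let ?\<phi> = "subst B A g"
    have \<phi>: "cont_hom B A ?\<phi>" using g by (rule cont_hom_subst)
    have "cont_hom_to B T (\<pi> \<circ> ?\<phi>)"
      unfolding cont_hom_to_def
    proof (intro conjI ballI)
      fix u assume u: "u \<in> Omega B"
      then have \<phi>u: "?\<phi> u \<in> Omega A" using \<phi> by (simp add: cont_hom_def)
      then show "(\<pi> \<circ> ?\<phi>) u \<in> carr T" using T by simp
      obtain F where F: "finite F" "\<And>u'. u' \<in> Omega A \<Longrightarrow> agree F (?\<phi> u) u' \<Longrightarrow> \<pi> u' = \<pi> (?\<phi> u)"
        using \<pi> \<phi>u unfolding cont_hom_to_def by blast
      have "\<exists>G. finite G \<and> (\<forall>u'\<in>Omega B. agree G u u' \<longrightarrow> agree F (?\<phi> u) (?\<phi> u'))"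
        using \<phi> u F(1) by (simp add: cont_hom_def)
      then obtain G where "finite G" "\<forall>u'\<in>Omega B. agree G u u' \<longrightarrow> agree F (?\<phi> u) (?\<phi> u')"
        by auto
      then show "\<exists>G. finite G \<and> (\<forall>u'\<in>Omega B. agree G u u' \<longrightarrow> (\<pi> \<circ> ?\<phi>) u' = (\<pi> \<circ> ?\<phi>) u)"
        using F(2) \<phi> by (intro exI[of _ G]) (simp add: cont_hom_def)
    next
      fix u v assume "u \<in> Omega B" "v \<in> Omega B"
      then show "(\<pi> \<circ> ?\<phi>) (io_mult B u v) = mul T ((\<pi> \<circ> ?\<phi>) u) ((\<pi> \<circ> ?\<phi>) v)"
        using \<phi> \<pi> by (simp add: cont_hom_def cont_hom_to_def)
    qed
    moreover have "(\<lambda>b\<in>B. (\<pi> \<circ> ?\<phi>) (io_proj B b)) = (\<lambda>b\<in>B. \<psi> (io_proj B b))"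
      using g \<pi>g by (auto simp: subst_proj fun_eq_iff)
    ultimately have eq: "\<pi> (?\<phi> z) = \<psi> z" if "z \<in> Omega B" for z
      using cont_hom_to_eval[OF _ T(1) that] \<psi> by (metis comp_apply)
    have "provable \<Sigma> A (?\<phi> x) (?\<phi> y)"
      using Sigma0I[OF instancesI[OF xy \<phi>], where env = "\<lambda>_. w" and t = "Var 0"] w by (intro provable.base) simp
    then show ?thesis using ker eq Omega by metis
  qed
  then show ?thesis using T(1) by (auto simp: models_def holds_in_def)
qed

end

theorem theorem9p2:
  fixes \<Sigma> :: "(nat set \<times> io \<times> io) set" and B :: "nat set" and u v :: io
  assumes "\<Sigma> \<noteq> {}"
    and "\<forall>p\<in>\<Sigma>. is_pseudoid p"
    and "is_pseudoid (B, u, v)"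
    and "\<forall>T\<in>models \<Sigma>. holds_in T (B, u, v)"
  shows "provable \<Sigma> B u v"
proof (rule ccontr)
  assume neg: "\<not> provable \<Sigma> B u v"
  have B: "finite B" "u \<in> Omega B" "v \<in> Omega B" using assms(3) by (auto simp: is_pseudoid_def)
  interpret closed_cong B "provable \<Sigma> B"
    using provable_closed_cong assms(1,2) B by blast
  obtain T \<pi> where T: "CS T" "carr T = \<pi> ` Omega B" "cont_hom_to B T \<pi>"
    "\<And>x y. provable \<Sigma> B x y \<Longrightarrow> \<pi> x = \<pi> y" "\<pi> u \<noteq> \<pi> v"
    using separating_quotient[OF B(2,3) neg] by blast
  then have "T \<in> models \<Sigma>" using quotient_in_models[OF assms(2) _ _ _ _ B(2)] by blast
  then have "holds_in T (B, u, v)" using assms(4) by blast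
  then show False using T(3,5) by (simp add: holds_in_def)
qed

end
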